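(* Let $p\ge5$ be an odd prime and put $g:=\left\lfloor\frac{p-1}{4}\right\rfloor$. If $n$ is a positive integer with $n\le (p-1)/2$ and $$n=ag+r,\qquad 0\le r<g,$$ with $a,r$ integers, then $$G(g,n)\le p-\left\lceil \frac{p+\frac{g a(a-1)}2+ra}{n}\right\rceil.$$ The same bound is valid for every larger target multiplicity: for every integer $g'\ge g$, $G(g',n)$ is at most the same right-hand side (computed with the original $g,a,r$).
   Context: A finite set $\mathcal{G}\subset\mathbb{Z}$ is a $g$-Golomb ruler if for every positive integer $d$ the number of pairs $(a,c)\in \mathcal{G}^2$ with $c-a=d$ is at most $g$. $G(g,n)$ denotes the minimum possible diameter (largest element minus smallest element) of a $g$-Golomb ruler with exactly $n$ elements (marks). *)

theory Defs
  imports Complex_Main "HOL-Computational_Algebra.Primes"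
begin

definition golomb_ruler :: "nat \<Rightarrow> int set \<Rightarrow> bool" where
  "golomb_ruler g S \<longleftrightarrow>
     finite S \<and> (\<forall>d>0. card {(a, c). a \<in> S \<and> c \<in> S \<and> c - a = d} \<le> g)"

definition ruler_diameter :: "int set \<Rightarrow> int" where
  "ruler_diameter S = Max S - Min S"

text \<open>
  Meaningful only for \<open>g \<ge> 1\<close> and \<open>n \<ge> 1\<close>: then the minimum is taken over a nonempty set of
  natural numbers (\<open>golomb_ruler_exists\<close>, \<open>min_golomb_diameter_attained\<close>).
\<close>
definition min_golomb_diameter :: "nat \<Rightarrow> nat \<Rightarrow> nat" where
  "min_golomb_diameter g n =
     (LEAST D. \<exists>S. golomb_ruler g S \<and> card S = n \<and> ruler_diameter S = int D)"

lemma power2_diff_inj: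
  fixes i j k l :: nat
  assumes "(2::int) ^ j - 2 ^ i = 2 ^ l - 2 ^ k" and "(2::int) ^ j - 2 ^ i > 0"
  shows "j = l"
proof -
  have no: "\<not> b < d"
    if eq: "(2::int) ^ b - 2 ^ a = 2 ^ d - 2 ^ c" and pos: "(2::int) ^ b - 2 ^ a > 0"
    for a b c d :: nat
  proof
    assume "b < d"
    have "(2::int) ^ c < 2 ^ d" using eq pos by linarith
    then have "c < d" by simp
    then have "Suc c \<le> d" "Suc b \<le> d" using \<open>b < d\<close> by auto
    then have "(2::int) ^ Suc c \<le> 2 ^ d" "(2::int) ^ Suc b \<le> 2 ^ d"
      by (intro power_increasing; simp)+
    moreover have "(2::int) ^ a > 0" by simp
    ultimately show False using eq by simp
  qed
  show ?thesis using no[OF assms] no[of l k j i] assms by simp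
qed

lemma golomb_ruler_exists:
  assumes "g \<ge> 1"
  shows "\<exists>S. golomb_ruler g S \<and> card S = n"
proof (intro exI conjI)
  let ?S = "(\<lambda>i. (2::int) ^ i) ` {..<n}"
  show "card ?S = n" by (subst card_image) (auto simp: inj_on_def)
  show "golomb_ruler g ?S"
    unfolding golomb_ruler_def
  proof (intro conjI allI impI)
    fix d :: int
    assume d: "d > 0"
    let ?P = "{(a, c). a \<in> ?S \<and> c \<in> ?S \<and> c - a = d}"
    have eq: "x = y" if "x \<in> ?P" "y \<in> ?P" for x y
    proof -
      obtain i j where x: "x = (2 ^ i, 2 ^ j)" "(2::int) ^ j - 2 ^ i = d"
        using \<open>x \<in> ?P\<close> by auto
      obtain k l where y: "y = (2 ^ k, 2 ^ l)" "(2::int) ^ l - 2 ^ k = d"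
        using \<open>y \<in> ?P\<close> by auto
      have "j = l" by (rule power2_diff_inj[of j i l k]) (use x y d in auto)
      have "(2::int) ^ i = 2 ^ j - d" "(2::int) ^ k = 2 ^ l - d"
        using x(2) y(2) by (simp_all add: algebra_simps)
      then have "(2::int) ^ i = 2 ^ k" by (simp only: \<open>j = l\<close>)
      then show ?thesis by (simp only: x(1) y(1) \<open>j = l\<close>)
    qed
    have fin: "finite ?P" by (rule finite_subset[of _ "?S \<times> ?S"]) auto
    have "card ?P \<le> Suc 0"
      unfolding card_le_Suc0_iff_eq[OF fin] by (intro ballI eq)
    then show "card ?P \<le> g" using assms by linarith
  qed simp
qed

lemma min_golomb_diameter_attained:
  assumes "g \<ge> 1" "n \<ge> 1"
  shows "\<exists>S. golomb_ruler g S \<and> card S = n \<and>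
             ruler_diameter S = int (min_golomb_diameter g n)"
proof -
  obtain S where S: "golomb_ruler g S" "card S = n"
    using golomb_ruler_exists[OF assms(1)] by blast
  then have "finite S" "S \<noteq> {}" using assms(2) by (auto simp: golomb_ruler_def)
  then have "ruler_diameter S \<ge> 0" by (simp add: ruler_diameter_def)
  then have "ruler_diameter S = int (nat (ruler_diameter S))" by simp
  with S have "\<exists>D. \<exists>S. golomb_ruler g S \<and> card S = n \<and> ruler_diameter S = int D" by blast
  then show ?thesis unfolding min_golomb_diameter_def by (rule LeastI_ex)
qed

end

theory Submission
  imports Defs "HOL-Number_Theory.Cong"
begin

text \<open>
  The nonzero squares modulo \<open>p\<close> form a set of \<open>(p - 1) / 2\<close> residues in which every nonzero
  residue \<open>d\<close> is a difference at most \<open>g\<close> times: each representation \<open>d = v\<^sup>2 - u\<^sup>2\<close> with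
  \<open>u, v \<noteq> 0\<close> yields, through the four choices of signs, four distinct units \<open>w = v - u\<close>, because
  \<open>w\<close> and \<open>d\<close> determine \<open>v + u\<close>. Hence four times the number of representations is at most
  \<open>p - 1\<close>.

  Choose any \<open>n\<close> of these squares and cut the circle of residues at a longest gap, of length
  \<open>M\<close>; this gives a ruler of diameter \<open>p - M\<close>. The \<open>n\<close> gaps sum to \<open>p\<close>, and no value is taken by
  more than \<open>g\<close> of them, so the numbers \<open>M - gap\<close> sum to at least
  \<open>g (0 + 1 + \<dots> + (a - 1)) + r a\<close>. Therefore \<open>n M \<ge> p + g a (a - 1) / 2 + r a\<close>.
\<close>

section \<open>Rulers on the circle of residues and their lifts to the integers\<close>

definition modular_golomb_ruler :: "nat \<Rightarrow> nat \<Rightarrow> int set \<Rightarrow> bool" where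
  "modular_golomb_ruler p g S \<longleftrightarrow> S \<subseteq> {0..<int p} \<and>
     (\<forall>d. \<not> int p dvd d \<longrightarrow> card {(a, c). a \<in> S \<and> c \<in> S \<and> [c - a = d] (mod int p)} \<le> g)"

lemma modular_golomb_ruler_finite: "modular_golomb_ruler p g S \<Longrightarrow> finite S"
  by (auto simp: modular_golomb_ruler_def intro: finite_subset)

lemma finite_difference_pairs:
  "finite S \<Longrightarrow> finite {(a, c). a \<in> S \<and> c \<in> S \<and> P a c}"
  by (rule finite_subset[of _ "S \<times> S"]) auto

lemma modular_golomb_ruler_subset:
  assumes "modular_golomb_ruler p g S" "T \<subseteq> S"
  shows "modular_golomb_ruler p g T"
  unfolding modular_golomb_ruler_def
proof (intro conjI allI impI)
  show "T \<subseteq> {0..<int p}" using assms by (auto simp: modular_golomb_ruler_def)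
  fix d assume d: "\<not> int p dvd d"
  have "card {(a, c). a \<in> T \<and> c \<in> T \<and> [c - a = d] (mod int p)}
      \<le> card {(a, c). a \<in> S \<and> c \<in> S \<and> [c - a = d] (mod int p)}"
    using assms modular_golomb_ruler_finite
    by (intro card_mono finite_difference_pairs) auto
  also have "\<dots> \<le> g" using assms(1) d by (simp add: modular_golomb_ruler_def)
  finally show "card {(a, c). a \<in> T \<and> c \<in> T \<and> [c - a = d] (mod int p)} \<le> g" .
qed

lemma golomb_ruler_mono: "golomb_ruler g S \<Longrightarrow> g \<le> g' \<Longrightarrow> golomb_ruler g' S"
  unfolding golomb_ruler_def using le_trans by blast

text \<open>Reduction modulo \<open>p\<close> sends pairs of \<open>T\<close> with difference
  \<open>d\<close> injectively to pairs of \<open>S\<close> with difference congruent to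
  \<open>d\<close>. If \<open>p\<close> divides \<open>d\<close> there are none, since the two
  entries would be distinct yet congruent.\<close>

lemma golomb_ruler_of_modular:
  assumes S: "modular_golomb_ruler p g S" and "finite T"
    and T: "inj_on (\<lambda>x. x mod int p) T" "(\<lambda>x. x mod int p) ` T \<subseteq> S"
  shows "golomb_ruler g T"
  unfolding golomb_ruler_def
proof (intro conjI allI impI)
  show "finite T" by fact
  fix d :: int assume "d > 0"
  let ?P = "{(a, c). a \<in> T \<and> c \<in> T \<and> c - a = d}"
  let ?m = "\<lambda>(a, c). (a mod int p, c mod int p)"
  show "card ?P \<le> g"
  proof (cases "int p dvd d")
    case True
    have "?P = {}"
    proof (safe, simp)
      fix a c assume "a \<in> T" "c \<in> T" "d = c - a"
      then have "a mod int p = c mod int p" using True by (simp add: mod_eq_dvd_iff dvd_diff_commute)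
      then have "a = c" using T(1) \<open>a \<in> T\<close> \<open>c \<in> T\<close> by (auto dest: inj_onD)
      then show False using \<open>d > 0\<close> \<open>d = c - a\<close> by simp
    qed
    then show ?thesis by (simp only: card.empty le0)
  next
    case False
    have "inj_on ?m ?P" using T(1) by (auto simp: inj_on_def)
    moreover have "?m ` ?P \<subseteq> {(a, c). a \<in> S \<and> c \<in> S \<and> [c - a = d] (mod int p)}"
      using T(2) by (auto simp: cong_def mod_simps)
    ultimately have "card ?P \<le> card {(a, c). a \<in> S \<and> c \<in> S \<and> [c - a = d] (mod int p)}"
      using S by (intro card_inj_on_le finite_difference_pairs modular_golomb_ruler_finite)
    also have "\<dots> \<le> g" using S False by (simp add: modular_golomb_ruler_def)
    finally show ?thesis .
  qed
qed

lemma min_golomb_diameter_le: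
  assumes "golomb_ruler g S" "S \<noteq> {}"
  shows "int (min_golomb_diameter g (card S)) \<le> ruler_diameter S"
proof -
  have "finite S" using assms by (simp add: golomb_ruler_def)
  then have nn: "ruler_diameter S \<ge> 0" using assms(2) by (simp add: ruler_diameter_def)
  have "min_golomb_diameter g (card S) \<le> nat (ruler_diameter S)"
    unfolding min_golomb_diameter_def by (rule Least_le) (use assms nn in auto)
  then show ?thesis using nn by linarith
qed

section \<open>Gaps between cyclically consecutive residues\<close>

text \<open>For \<open>x\<close> in \<open>S\<close>, the distance to the next element on walking
  upward around the circle. Because of \<open>d > 0\<close>, a lone element has gap
  \<open>p\<close>, a full turn.\<close>

definition cyclic_gap :: "nat \<Rightarrow> int set \<Rightarrow> int \<Rightarrow> nat" where
  "cyclic_gap p S x = (LEAST d. d > 0 \<and> (x + int d) mod int p \<in> S)"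

context
  fixes p :: nat and S :: "int set"
  assumes p: "p > 0" and S: "S \<subseteq> {0..<int p}"
begin

lemma cyclic_gap_witness: "x \<in> S \<Longrightarrow> p > 0 \<and> (x + int p) mod int p \<in> S"
  using p S by auto

lemma cyclic_gap:
  assumes "x \<in> S"
  shows "cyclic_gap p S x > 0" "(x + int (cyclic_gap p S x)) mod int p \<in> S"
  using LeastI[of "\<lambda>d. d > 0 \<and> (x + int d) mod int p \<in> S", OF cyclic_gap_witness[OF assms]]
  unfolding cyclic_gap_def by blast+

lemma cyclic_gap_le: "d > 0 \<Longrightarrow> (x + int d) mod int p \<in> S \<Longrightarrow> cyclic_gap p S x \<le> d"
  unfolding cyclic_gap_def by (rule Least_le) simp

lemma cyclic_gap_le_modulus: "x \<in> S \<Longrightarrow> cyclic_gap p S x \<le> p"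
  using cyclic_gap_le cyclic_gap_witness by blast

text \<open>The arcs from each point of \<open>S\<close> up to the next one cover the circle: a
  residue \<open>y\<close> lies in the arc of the first point met on walking back from
  \<open>y\<close>.\<close>

lemma sum_cyclic_gap_ge:
  assumes "S \<noteq> {}"
  shows "p \<le> (\<Sum>x\<in>S. cyclic_gap p S x)"
proof -
  have fin: "finite S" using S by (rule finite_subset) simp
  let ?arc = "\<lambda>x. (\<lambda>t. (x + int t) mod int p) ` {..<cyclic_gap p S x}"
  have "{0..<int p} \<subseteq> (\<Union>x\<in>S. ?arc x)"
  proof
    fix y assume y: "y \<in> {0..<int p}"
    define t where "t = (LEAST t. (y - int t) mod int p \<in> S)"
    obtain s where s: "s \<in> S" using assms by blast
    \<comment> \<open>Walking back \<open>(y - s) mod p\<close> steps from \<open>y\<close> reaches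
      \<open>s\<close>, so the \<open>LEAST\<close> in \<open>t\<close> is attained.\<close>
    have "(y - int (nat ((y - s) mod int p))) mod int p = s mod int p"
      using p by (simp add: mod_simps)
    also have "\<dots> = s" using s S by auto
    finally have ex: "(y - int (nat ((y - s) mod int p))) mod int p \<in> S" using s by simp
    define x where "x = (y - int t) mod int p"
    have x: "x \<in> S" unfolding x_def t_def by (rule LeastI[of "\<lambda>t. (y - int t) mod int p \<in> S", OF ex])
    have yx: "(x + int t) mod int p = y" using y by (simp add: x_def mod_simps)
    \<comment> \<open>Otherwise the successor of \<open>x\<close> would already be met after
      \<open>t - ?c\<close> backward steps, against the minimality of \<open>t\<close>.\<close>
    have "t < cyclic_gap p S x"
    proof (rule ccontr)
      let ?c = "cyclic_gap p S x"
      assume "\<not> t < ?c"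
      then have "int (t - ?c) = int t - int ?c" by simp
      then have "(y - int (t - ?c)) mod int p = (x + int ?c) mod int p"
        by (simp add: x_def mod_simps algebra_simps)
      then have "(y - int (t - ?c)) mod int p \<in> S" using cyclic_gap(2)[OF x] by simp
      then have "t \<le> t - ?c" unfolding t_def by (rule Least_le)
      then show False using cyclic_gap(1)[OF x] \<open>\<not> t < ?c\<close> by simp
    qed
    then show "y \<in> (\<Union>x\<in>S. ?arc x)" using x yx by force
  qed
  then have "card {0..<int p} \<le> card (\<Union>x\<in>S. ?arc x)"
    by (rule card_mono[rotated]) (use fin in auto)
  also have "\<dots> \<le> (\<Sum>x\<in>S. card (?arc x))" by (rule card_UN_le[OF fin])
  also have "\<dots> \<le> (\<Sum>x\<in>S. cyclic_gap p S x)"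
    by (intro sum_mono) (metis card_image_le card_lessThan finite_lessThan)
  finally show ?thesis by simp
qed

text \<open>The circle is cut inside the gap after \<open>x\<close> and unrolled from the end of
  that gap. The last lifted point is then at most \<open>x + p\<close>, the next copy of
  \<open>x\<close>.\<close>

lemma cut_at_gap:
  assumes x: "x \<in> S"
  obtains T where "inj_on (\<lambda>y. y mod int p) T" "(\<lambda>y. y mod int p) ` T = S" "card T = card S"
    "finite T" "ruler_diameter T \<le> int p - int (cyclic_gap p S x)"
proof
  let ?c = "int (cyclic_gap p S x)"
  \<comment> \<open>\<open>f s\<close> is the representative of \<open>s\<close> in the window of
    length \<open>p\<close> that starts at \<open>x + ?c\<close>.\<close>
  define f where "f s = x + ?c + (s - x - ?c) mod int p" for s
  have fm: "f s mod int p = s" if "s \<in> S" for s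
    using that S by (auto simp: f_def mod_simps)
  then have inj: "inj_on f S" by (metis inj_onI)
  show "inj_on (\<lambda>y. y mod int p) (f ` S)" using fm by (auto simp: inj_on_def)
  show "(\<lambda>y. y mod int p) ` f ` S = S" using fm by (auto simp: image_image)
  show "card (f ` S) = card S" by (rule card_image[OF inj])
  have "finite S" using S by (rule finite_subset) simp
  then show fin: "finite (f ` S)" by simp
  have lower: "x + ?c \<le> f s" for s using p by (simp add: f_def)
  \<comment> \<open>A point above \<open>x + p\<close> reduces to \<open>x + d\<close> with
    \<open>d > 0\<close>, so \<open>d\<close> is at least the gap; but the window ends before
    \<open>x + ?c + p\<close>.\<close>
  have upper: "f s \<le> x + int p" if "s \<in> S" for s
  proof (rule ccontr)
    assume "\<not> f s \<le> x + int p"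
    define d where "d = nat (f s - x - int p)"
    have d: "int d = f s - x - int p" using \<open>\<not> f s \<le> x + int p\<close> by (simp add: d_def)
    have "(x + int d) mod int p = f s mod int p" by (simp add: d)
    then have "(x + int d) mod int p \<in> S" using fm that by simp
    then have "cyclic_gap p S x \<le> d" using \<open>\<not> f s \<le> x + int p\<close> by (intro cyclic_gap_le) (auto simp: d_def)
    then have "int p \<le> (s - x - ?c) mod int p" using d by (simp add: f_def)
    then show False using p by (smt (verit) pos_mod_bound of_nat_0_less_iff)
  qed
  have "f ` S \<noteq> {}" using x by blast
  then have "Max (f ` S) \<le> x + int p" "x + ?c \<le> Min (f ` S)"
    using fin upper lower by auto
  then show "ruler_diameter (f ` S) \<le> int p - ?c" by (simp add: ruler_diameter_def)
qed

text \<open>A gap \<open>d\<close> strictly between 0 and \<open>p\<close> gives a pair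
  \<open>(x, x + d)\<close> of residues with difference \<open>d\<close>, so the ruler property
  applies. It says nothing for \<open>d = p\<close>, but a full-turn gap occurs at most once, and
  \<open>g > 0\<close> covers that case.\<close>

lemma card_cyclic_gap_fiber:
  assumes "modular_golomb_ruler p g S" "g > 0"
  shows "card {x \<in> S. cyclic_gap p S x = d} \<le> g"
proof -
  have fin: "finite S" using S by (rule finite_subset) simp
  let ?F = "{x \<in> S. cyclic_gap p S x = d}"
  consider "d = 0" | "d > p" | "d = p" | "0 < d" "d < p" by linarith
  then show ?thesis
  proof cases
    case 1
    then have "?F = {}" using cyclic_gap(1) by auto
    then show ?thesis by (simp only: card.empty le0)
  next
    case 2
    then have "?F = {}" using cyclic_gap_le_modulus by force
    then show ?thesis by (simp only: card.empty le0)
  next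
    case 3
    have "x = y" if "x \<in> ?F" "y \<in> ?F" for x y
    proof (rule ccontr)
      assume "x \<noteq> y"
      \<comment> \<open>The forward distance from \<open>x\<close> to \<open>y\<close>: it is
        positive and below \<open>p\<close>, so it bounds the gap at \<open>x\<close> away from
        \<open>p\<close>.\<close>
      define e where "e = nat ((y - x) mod int p)"
      have e: "int e = (y - x) mod int p" using p by (simp add: e_def)
      have "(y - x) mod int p \<noteq> 0"
      proof
        assume "(y - x) mod int p = 0"
        then have "y mod int p = x mod int p" by (simp add: mod_eq_dvd_iff mod_eq_0_iff_dvd)
        moreover have "y mod int p = y" "x mod int p = x" using that S by auto
        ultimately show False using \<open>x \<noteq> y\<close> by simp
      qed
      then have "e > 0" using e by linarith
      moreover have "(x + int e) mod int p = y" using that S by (auto simp: e mod_simps)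
      ultimately have "d \<le> e" using cyclic_gap_le[of e x] that by auto
      moreover have "int e < int p" unfolding e using p by simp
      ultimately show False using 3 by simp
    qed
    then have "card ?F \<le> Suc 0" using fin by (subst card_le_Suc0_iff_eq) auto
    then show ?thesis using \<open>g > 0\<close> by linarith
  next
    case 4
    let ?m = "\<lambda>x. (x, (x + int d) mod int p)"
    have "?m ` ?F \<subseteq> {(a, c). a \<in> S \<and> c \<in> S \<and> [c - a = int d] (mod int p)}"
      using cyclic_gap(2) by (auto simp: cong_def mod_simps)
    then have "card ?F \<le> card {(a, c). a \<in> S \<and> c \<in> S \<and> [c - a = int d] (mod int p)}"
      using fin by (intro card_inj_on_le[of ?m] finite_difference_pairs) (auto simp: inj_on_def)
    also have "\<dots> \<le> g"
    proof -
      have "\<not> int p dvd int d" using 4 by (auto dest: dvd_imp_le)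
      then show ?thesis using assms(1) by (simp add: modular_golomb_ruler_def)
    qed
    finally show ?thesis .
  qed
qed

end

section \<open>Existence of a long gap by counting\<close>

text \<open>Raising the cap from \<open>k\<close> to \<open>k + 1\<close> adds 1 for each point with
  \<open>h x > k\<close>, and at most \<open>(k + 1) * g\<close> points fail this. Summing
  \<open>card A - (k + 1) * g\<close> over \<open>k < a\<close> gives the bound, doubled and
  rearranged to avoid division and subtraction in \<open>nat\<close>.\<close>

lemma sum_min_ge_of_small_fibers:
  fixes h :: "'a \<Rightarrow> nat"
  assumes A: "finite A" and fib: "\<And>j. card {x \<in> A. h x = j} \<le> g"
  shows "2 * a * card A \<le> 2 * (\<Sum>x\<in>A. min (h x) a) + g * a * (a + 1)"
proof (induction a)
  case (Suc a)
  let ?L = "{x \<in> A. h x \<le> a}" and ?U = "{x \<in> A. a < h x}"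
  have "?L = (\<Union>j\<in>{..a}. {x \<in> A. h x = j})" by auto
  then have "card ?L \<le> (\<Sum>j\<in>{..a}. card {x \<in> A. h x = j})" by (metis card_UN_le finite_atMost)
  also have "\<dots> \<le> (\<Sum>j\<in>{..a}. g)" by (intro sum_mono fib)
  finally have L: "card ?L \<le> (a + 1) * g" by simp
  have "A = ?L \<union> ?U" by auto
  moreover have "card (?L \<union> ?U) = card ?L + card ?U"
    by (rule card_Un_disjoint) (use A in auto)
  ultimately have cA: "card A = card ?L + card ?U" by simp
  have "(\<Sum>x\<in>A. min (h x) (Suc a)) = (\<Sum>x\<in>A. min (h x) a + (if a < h x then 1 else 0))"
    by (rule sum.cong) auto
  also have "\<dots> = (\<Sum>x\<in>A. min (h x) a) + card ?U"
    using A by (simp add: sum.distrib sum.If_cases Int_def)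
  finally have step: "(\<Sum>x\<in>A. min (h x) (Suc a)) = (\<Sum>x\<in>A. min (h x) a) + card ?U" .
  have "2 * Suc a * card A = 2 * a * card A + 2 * card ?L + 2 * card ?U"
    by (simp add: cA algebra_simps)
  also have "\<dots> \<le> 2 * (\<Sum>x\<in>A. min (h x) a) + g * a * (a + 1) + 2 * ((a + 1) * g) + 2 * card ?U"
    using Suc.IH L by linarith
  also have "\<dots> = 2 * (\<Sum>x\<in>A. min (h x) (Suc a)) + g * Suc a * (Suc a + 1)"
    by (simp add: step algebra_simps)
  finally show ?case .
qed simp

text \<open>With \<open>M\<close> the largest gap, the deficits \<open>M - ?c y\<close> inherit the
  fiber bound of the gaps and have sum \<open>card S * M\<close> minus the sum of the gaps, hence at
  most \<open>card S * M - p\<close>.\<close>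

lemma exists_large_cyclic_gap:
  assumes p: "p > 0" and S: "modular_golomb_ruler p g S" and g: "g > 0" and "S \<noteq> {}"
    and card: "card S = a * g + r"
  obtains x where "x \<in> S"
    "2 * int p + int g * int a * (int a - 1) + 2 * int r * int a
       \<le> 2 * int (card S) * int (cyclic_gap p S x)"
proof -
  let ?c = "cyclic_gap p S"
  have sub: "S \<subseteq> {0..<int p}" using S by (simp add: modular_golomb_ruler_def)
  have fin: "finite S" using S by (rule modular_golomb_ruler_finite)
  have "Max (?c ` S) \<in> ?c ` S" using fin \<open>S \<noteq> {}\<close> by (intro Max_in) auto
  then obtain x where x: "x \<in> S" "?c x = Max (?c ` S)" by force
  define M where "M = ?c x"
  have le: "?c y \<le> M" if "y \<in> S" for y using that fin x by (simp add: M_def)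
  have "card {y \<in> S. M - ?c y = j} \<le> g" for j
  proof (cases "j \<le> M")
    case True
    then have "{y \<in> S. M - ?c y = j} = {y \<in> S. ?c y = M - j}" using le by force
    then show ?thesis using card_cyclic_gap_fiber[OF p sub S g] by simp
  next
    case False
    then have "{y \<in> S. M - ?c y = j} = {}" by auto
    then show ?thesis by (simp only: card.empty le0)
  qed
  from sum_min_ge_of_small_fibers[OF fin this, of a]
  have "2 * a * card S \<le> 2 * (\<Sum>y\<in>S. min (M - ?c y) a) + g * a * (a + 1)" .
  also have "(\<Sum>y\<in>S. min (M - ?c y) a) \<le> (\<Sum>y\<in>S. M - ?c y)" by (intro sum_mono) simp
  finally have 1: "2 * a * card S \<le> 2 * (\<Sum>y\<in>S. M - ?c y) + g * a * (a + 1)" by simp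
  have "(\<Sum>y\<in>S. M - ?c y) + (\<Sum>y\<in>S. ?c y) = card S * M"
    using le by (simp flip: sum.distrib)
  with 1 sum_cyclic_gap_ge[OF p sub \<open>S \<noteq> {}\<close>]
  have "2 * a * card S + 2 * p \<le> 2 * (card S * M) + g * a * (a + 1)" by linarith
  then have "int (2 * a * card S + 2 * p) \<le> int (2 * (card S * M) + g * a * (a + 1))"
    by (simp only: of_nat_le_iff)
  \<comment> \<open>For \<open>card S = a * g + r\<close>, the quantity
    \<open>2 * a * card S - g * a * (a + 1)\<close> becomes
    \<open>g * a * (a - 1) + 2 * r * a\<close>.\<close>
  then have "2 * int p + int g * int a * (int a - 1) + 2 * int r * int a \<le> 2 * int (card S) * int M"
    by (simp add: card algebra_simps)
  with x(1) show thesis unfolding M_def by (rule that)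
qed

section \<open>The nonzero squares as a modular ruler\<close>

text \<open>For odd \<open>p\<close>, half the nonzero range suffices, since \<open>u\<close> and
  \<open>-u\<close> have the same square.\<close>

definition quadratic_residues :: "nat \<Rightarrow> int set" where
  "quadratic_residues p = (\<lambda>u. u\<^sup>2 mod int p) ` {1..int ((p - 1) div 2)}"

context
  fixes p :: nat
  assumes p: "prime p" and odd: "odd p"
begin

lemma prime_dvd_double_iff: "int p dvd 2 * x \<longleftrightarrow> int p dvd x"
proof -
  have "\<not> int p dvd 2"
  proof
    assume "int p dvd 2"
    then have "p dvd 2" by (metis int_dvd_int_iff of_nat_numeral)
    then show False using p odd by (metis primes_dvd_imp_eq two_is_prime_nat even_numeral dvd_refl)
  qed
  then show ?thesis using p by (simp add: prime_dvd_mult_iff)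
qed

lemma card_quadratic_residues: "card (quadratic_residues p) = (p - 1) div 2"
proof -
  have "inj_on (\<lambda>u. u\<^sup>2 mod int p) {1..int ((p - 1) div 2)}"
  proof (rule inj_onI)
    fix u v assume u: "u \<in> {1..int ((p - 1) div 2)}" and v: "v \<in> {1..int ((p - 1) div 2)}"
      and "u\<^sup>2 mod int p = v\<^sup>2 mod int p"
    then have "int p dvd (u + v) * (u - v)"
      by (simp add: mod_eq_dvd_iff power2_eq_square algebra_simps)
    then have "int p dvd u + v \<or> int p dvd u - v" using p by (simp add: prime_dvd_mult_iff)
    moreover have "0 < u + v" "u + v < int p" "\<bar>u - v\<bar> < int p" using u v odd by (auto simp: odd_pos)
    ultimately show "u = v" using zdvd_not_zless dvd_imp_le_int[of "u - v" "int p"] by fastforce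
  qed
  then show ?thesis by (simp add: quadratic_residues_def card_image)
qed

lemma quadratic_residues_modular_golomb_ruler:
  "modular_golomb_ruler p ((p - 1) div 4) (quadratic_residues p)"
  unfolding modular_golomb_ruler_def
proof (intro conjI allI impI)
  have p0: "p > 0" using p by (rule prime_gt_0_nat)
  show sub: "quadratic_residues p \<subseteq> {0..<int p}" using p0 by (auto simp: quadratic_residues_def)
  then have fin: "finite (quadratic_residues p)" by (rule finite_subset) simp
  fix d assume d: "\<not> int p dvd d"
  let ?P = "{(a, c). a \<in> quadratic_residues p \<and> c \<in> quadratic_residues p \<and> [c - a = d] (mod int p)}"
  have "\<forall>q\<in>quadratic_residues p. \<exists>u. u\<^sup>2 mod int p = q \<and> \<not> int p dvd u"
  proof
    fix q assume "q \<in> quadratic_residues p"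
    then obtain u where u: "u\<^sup>2 mod int p = q" "1 \<le> u" "u \<le> int ((p - 1) div 2)"
      by (auto simp: quadratic_residues_def)
    then have "u < int p" using p0 by simp
    with u show "\<exists>u. u\<^sup>2 mod int p = q \<and> \<not> int p dvd u" using zdvd_not_zless[of u "int p"] by auto
  qed
  then obtain s where s: "\<And>q. q \<in> quadratic_residues p \<Longrightarrow> (s q)\<^sup>2 mod int p = q"
      "\<And>q. q \<in> quadratic_residues p \<Longrightarrow> \<not> int p dvd s q"
    by metis
  \<comment> \<open>The signs: \<open>e * s q\<close> for \<open>e\<close> in \<open>E\<close> are
    the two square roots of \<open>q\<close>.\<close>
  define E where "E = {1, -1 :: int}"
  have sq: "[(e * s q)\<^sup>2 = q] (mod int p)" if "e \<in> E" "q \<in> quadratic_residues p" for e q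
  proof -
    have "(e * s q)\<^sup>2 = (s q)\<^sup>2" using that(1) by (auto simp: E_def)
    then show ?thesis using s(1)[OF that(2)] that(2) sub by (auto simp: cong_def)
  qed
  have rep: "[(e * s c - f * s a) * (e * s c + f * s a) = d] (mod int p)"
    if "e \<in> E" "f \<in> E" "(a, c) \<in> ?P" for e f a c
  proof -
    have "(e * s c - f * s a) * (e * s c + f * s a) = (e * s c)\<^sup>2 - (f * s a)\<^sup>2"
      by (simp add: power2_eq_square algebra_simps)
    also have "[\<dots> = c - a] (mod int p)" using that by (intro cong_diff sq) auto
    also have "[c - a = d] (mod int p)" using that by simp
    finally show ?thesis .
  qed
  \<comment> \<open>Squaring removes the signs and gives \<open>b = c\<close>; opposite signs would
    then make \<open>p\<close> divide \<open>2 * s c\<close>.\<close>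
  have det: "e = f \<and> b = c"
    if "e \<in> E" "f \<in> E" "b \<in> quadratic_residues p" "c \<in> quadratic_residues p"
      "[e * s b = f * s c] (mod int p)" for e f b c
  proof -
    have "[b = (e * s b)\<^sup>2] (mod int p)" using sq that by (metis cong_sym)
    also have "[(e * s b)\<^sup>2 = (f * s c)\<^sup>2] (mod int p)" using that by (intro cong_pow)
    also have "[(f * s c)\<^sup>2 = c] (mod int p)" using sq that by simp
    finally have "b mod int p = c mod int p" by (simp add: cong_def)
    moreover have "b mod int p = b" "c mod int p = c" using that sub by auto
    ultimately have "b = c" by simp
    moreover have "e = f"
    proof (rule ccontr)
      assume "e \<noteq> f"
      then have "e * s c - f * s c = 2 * s c \<or> e * s c - f * s c = - (2 * s c)"
        using that(1,2) by (auto simp: E_def)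
      moreover have "int p dvd e * s c - f * s c" using that(5) \<open>b = c\<close> by (simp add: cong_iff_dvd_diff)
      ultimately have "int p dvd 2 * s c" by (metis dvd_minus_iff)
      then show False using s(2)[OF that(4)] by (simp add: prime_dvd_double_iff)
    qed
    ultimately show ?thesis by simp
  qed
  let ?w = "\<lambda>((e, f), (a, c)). (e * s c - f * s a) mod int p"
  have inj: "e = e' \<and> f = f' \<and> a = a' \<and> c = c'"
    if E: "e \<in> E" "f \<in> E" "e' \<in> E" "f' \<in> E"
      and ac: "(a, c) \<in> ?P" and ac': "(a', c') \<in> ?P"
      and w: "[e * s c - f * s a = e' * s c' - f' * s a'] (mod int p)"
    for e f a c e' f' a' c'
  proof -
    let ?w = "e * s c - f * s a" and ?w' = "e' * s c' - f' * s a'"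
      and ?z = "e * s c + f * s a" and ?z' = "e' * s c' + f' * s a'"
    have r: "[?w * ?z = d] (mod int p)" using rep E ac by blast
    have r': "[?w' * ?z' = d] (mod int p)" using rep E ac' by blast
    \<comment> \<open>Since \<open>?w * ?z\<close> is congruent to \<open>d\<close>, the factor
      \<open>?w\<close> is a unit and can be cancelled, so \<open>?w\<close> determines
      \<open>?z\<close>.\<close>
    have "\<not> int p dvd ?w" using r d by (meson cong_dvd_iff dvd_mult2)
    then have cop: "coprime ?w (int p)"
      using p by (metis coprime_commute prime_imp_coprime prime_nat_int_transfer)
    have "[?w * ?z = ?w' * ?z'] (mod int p)" using r r' by (metis cong_sym cong_trans)
    also have "[?w' * ?z' = ?w * ?z'] (mod int p)" using w by (intro cong_mult cong_refl) (rule cong_sym)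
    finally have z: "[?z = ?z'] (mod int p)" using cop by (simp add: cong_mult_lcancel)
    \<comment> \<open>\<open>?z + ?w\<close> and \<open>?z - ?w\<close> are twice the two signed
      roots.\<close>
    have "int p dvd 2 * (e * s c - e' * s c')" "int p dvd 2 * (f * s a - f' * s a')"
      using cong_add[OF z w] cong_diff[OF z w] by (simp_all add: cong_iff_dvd_diff algebra_simps)
    then have "[e * s c = e' * s c'] (mod int p)" "[f * s a = f' * s a'] (mod int p)"
      unfolding prime_dvd_double_iff by (simp_all add: cong_iff_dvd_diff)
    then show ?thesis using det E ac ac' by blast
  qed
  have "inj_on ?w ((E \<times> E) \<times> ?P)"
  proof (rule inj_onI)
    fix X Y assume XY: "X \<in> (E \<times> E) \<times> ?P" "Y \<in> (E \<times> E) \<times> ?P" and eq: "?w X = ?w Y"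
    obtain e f a c e' f' a' c' where [simp]: "X = ((e, f), (a, c))" "Y = ((e', f'), (a', c'))"
      by (metis surj_pair)
    show "X = Y" using inj[of e f e' f' a c a' c'] XY eq by (simp add: cong_def)
  qed
  moreover have "?w ` ((E \<times> E) \<times> ?P) \<subseteq> {1..<int p}"
  proof clarify
    fix e f a c
    assume E: "e \<in> E" "f \<in> E" and ac: "a \<in> quadratic_residues p" "c \<in> quadratic_residues p"
      "[c - a = d] (mod int p)"
    let ?w = "e * s c - f * s a"
    have "[?w * (e * s c + f * s a) = d] (mod int p)" using rep E ac by simp
    then have "?w mod int p \<noteq> 0" using d by (metis cong_dvd_iff dvd_mult2 mod_eq_0_iff_dvd)
    moreover have "0 \<le> ?w mod int p" "?w mod int p < int p" using p0 by simp_all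
    ultimately show "?w mod int p \<in> {1..<int p}" by simp
  qed
  ultimately have "card ((E \<times> E) \<times> ?P) \<le> card {1..<int p}" by (intro card_inj_on_le) auto
  \<comment> \<open>The factor 4 is the number of sign pairs; \<open>p - 1\<close> counts the
    nonzero residues.\<close>
  then have "4 * card ?P \<le> p - 1" by (simp add: card_cartesian_product E_def)
  then show "card ?P \<le> (p - 1) div 4" by linarith
qed

end

section \<open>The diameter bound\<close>

theorem corollary11:
  fixes p g n :: nat and a r :: int
  assumes "prime p" and "odd p" and "p \<ge> 5"
    and "int g = \<lfloor>(real p - 1) / 4\<rfloor>"
    and "n > 0" and "real n \<le> (real p - 1) / 2"
    and "int n = a * int g + r" and "0 \<le> r" and "r < int g"
  shows "int (min_golomb_diameter g n)
           \<le> int p - \<lceil>(real p + real g * real_of_int a * (real_of_int a - 1) / 2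
                        + real_of_int r * real_of_int a) / real n\<rceil>
         \<and> (\<forall>g'\<ge>g. int (min_golomb_diameter g' n)
           \<le> int p - \<lceil>(real p + real g * real_of_int a * (real_of_int a - 1) / 2
                        + real_of_int r * real_of_int a) / real n\<rceil>)"
proof -
  have "(real p - 1) / 4 = real_of_int (int (p - 1)) / real_of_int 4" using assms(3) by simp
  then have "int g = int (p - 1) div 4" using assms(4) by (metis floor_divide_of_int_eq)
  then have g: "g = (p - 1) div 4" by linarith
  have "real (2 * n) \<le> real (p - 1)" using assms(3,6) by simp
  then have n: "n \<le> card (quadratic_residues p)"
    unfolding card_quadratic_residues[OF assms(1,2)] of_nat_le_iff by linarith
  then obtain S where sub: "S \<subseteq> quadratic_residues p" and card: "card S = n"
    by (meson obtain_subset_with_card_n)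
  have S: "modular_golomb_ruler p g S"
    using quadratic_residues_modular_golomb_ruler[OF assms(1,2)] sub
    unfolding g by (rule modular_golomb_ruler_subset)
  then have S': "S \<subseteq> {0..<int p}" by (simp add: modular_golomb_ruler_def)
  \<comment> \<open>Since \<open>n > 0\<close> and \<open>r < g\<close>, the product
    \<open>a * g = n - r\<close> exceeds \<open>-g\<close>, which excludes negative
    \<open>a\<close>.\<close>
  have "- 1 * int g < a * int g" using assms(5,7,9) by linarith
  then have "a \<ge> 0" by (simp only: mult_less_cancel_right) auto
  then obtain a' r' where a: "a = int a'" and r: "r = int r'"
    using assms(8) by (metis nonneg_int_cases)
  have "int n = int (a' * g + r')" using assms(7) by (simp add: a r)
  then have n': "card S = a' * g + r'" unfolding card of_nat_eq_iff .
  have p0: "p > 0" and g0: "g > 0" and S0: "S \<noteq> {}" using assms(3,5,8,9) card by auto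
  obtain x where x: "x \<in> S" and gap: "2 * int p + int g * a * (a - 1) + 2 * r * a
      \<le> 2 * int n * int (cyclic_gap p S x)"
    using exists_large_cyclic_gap[OF p0 S g0 S0 n'] unfolding a r card by metis
  let ?B = "\<lceil>(real p + real g * real_of_int a * (real_of_int a - 1) / 2
    + real_of_int r * real_of_int a) / real n\<rceil>"
  from gap have "real_of_int (2 * int p + int g * a * (a - 1) + 2 * r * a)
      \<le> real_of_int (2 * int n * int (cyclic_gap p S x))"
    by (simp only: of_int_le_iff)
  \<comment> \<open>Division by \<open>2 * n\<close> bounds the real quotient by the gap, and the
    gap is an integer, so the ceiling obeys the same bound.\<close>
  then have B: "?B \<le> int (cyclic_gap p S x)"
    using assms(5) by (simp add: ceiling_le_iff field_simps)
  obtain T where T: "inj_on (\<lambda>y. y mod int p) T" "(\<lambda>y. y mod int p) ` T = S" "card T = card S"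
    "finite T" "ruler_diameter T \<le> int p - int (cyclic_gap p S x)"
    by (rule cut_at_gap[OF p0 S' x])
  have "golomb_ruler g T" using S T by (intro golomb_ruler_of_modular) auto
  moreover have "T \<noteq> {}" using T(2) S0 by blast
  \<comment> \<open>The same \<open>T\<close> is a ruler for every \<open>g' \<ge> g\<close>; the
    first conjunct of the goal is the case \<open>g' = g\<close>.\<close>
  ultimately have "int (min_golomb_diameter g' n) \<le> int p - ?B" if "g' \<ge> g" for g'
    using min_golomb_diameter_le[of g' T] golomb_ruler_mono[OF _ that] T(3,5) card B by fastforce
  then show ?thesis by blast
qed

end
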